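(* Let $K$ be an algebraically closed field, $m\geq 2$ and $\Gamma\in\mathbb{S}(m)$. The map $$\mathcal{A}(m,\Gamma)\to\widehat{\mathcal{A}}(m,\Gamma),\quad A\mapsto A+x^mK[[x]],$$ is a bijection, with inverse $B\mapsto B/x^mK[[x]]+x^mK[x]$, where $B/x^mK[[x]]$ is regarded as a subspace of $\bigoplus_{i=0}^{m-1}Kx^i\subseteq K[x]$.
   Context: $\mathbb{S}(m)$ is the set consisting of the empty set and of all non-empty subsets $\Gamma\subseteq\{2,\ldots,m-2\}$ such that $\Gamma+\Gamma\subseteq\Gamma\cup[m,\infty)$. $\mathcal{A}(m)$ is the set of all $K$-subalgebras $A$ of $K[x]$ such that $x^mK[x]\subset A$ and $x^{m-1}\notin A$. For $A\in\mathcal{A}(m)$, $\Gamma_A$ is the set of integers $\gamma$ with $1\leq\gamma\leq m-1$ such that $A$ contains an element of the form $x^\gamma+\sum_{j>\gamma}\lambda_jx^j$ with $\lambda_j\in K$; one has $\Gamma_A\in\mathbb{S}(m)$. $\mathcal{A}(m,\Gamma):=\{A\in\mathcal{A}(m)\mid\Gamma_A=\Gamma\}$. $\widehat{\mathcal{A}}(m)$ is the set of all $K$-subalgebras $B$ of the power series algebra $K[[x]]$ such that $x^mK[[x]]\subset B$ and $x^{m-1}\notin B$; $\Gamma_B$ is defined in the same way (integers $1\leq\gamma\leq m-1$ such that $B$ contains an element $x^\gamma+\sum_{j>\gamma}\lambda_jx^j$), and $\widehat{\mathcal{A}}(m,\Gamma):=\{B\in\widehat{\mathcal{A}}(m)\mid\Gamma_B=\Gamma\}$.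 The quotient $K[[x]]/x^mK[[x]]$ is identified as a vector space with $\bigoplus_{i=0}^{m-1}Kx^i$. *)

theory Defs
  imports
    "HOL-Computational_Algebra.Computational_Algebra"
    "HOL-Library.Set_Algebras"
begin

definition semigroup_parts :: "nat \<Rightarrow> nat set set" where
  "semigroup_parts m =
     {\<Gamma>. \<Gamma> = {} \<or> (\<Gamma> \<noteq> {} \<and> \<Gamma> \<subseteq> {2..m - 2} \<and> \<Gamma> + \<Gamma> \<subseteq> \<Gamma> \<union> {m..})}"

text \<open>Algebras are unital, so subalgebras contain 1. The constant \<open>module.subspace\<close>
  has its intended meaning only when \<open>scale\<close> is a module structure; the two scalings
  used below are vector space structures by the two lemmas that follow.\<close>

definition is_subalgebra :: "('k::field \<Rightarrow> 'a \<Rightarrow> 'a) \<Rightarrow> 'a::comm_ring_1 set \<Rightarrow> bool" where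
  "is_subalgebra scale A \<longleftrightarrow>
     module.subspace scale A \<and> 1 \<in> A \<and> (\<forall>a\<in>A. \<forall>b\<in>A. a * b \<in> A)"

abbreviation fps_scale :: "'k::field \<Rightarrow> 'k fps \<Rightarrow> 'k fps" where
  "fps_scale c f \<equiv> fps_const c * f"

lemma vector_space_smult: "vector_space (smult :: 'k::field \<Rightarrow> 'k poly \<Rightarrow> 'k poly)"
  by unfold_locales (simp_all add: smult_add_left smult_add_right)

lemma vector_space_fps_scale: "vector_space (fps_scale :: 'k::field \<Rightarrow> 'k fps \<Rightarrow> 'k fps)"
  by unfold_locales (simp_all add: distrib_left distrib_right mult.assoc
      flip: fps_const_add fps_const_mult)

definition poly_tail :: "nat \<Rightarrow> 'k::field poly set" where
  "poly_tail m = range (\<lambda>q. monom 1 m * q)"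

definition fps_tail :: "nat \<Rightarrow> 'k::field fps set" where
  "fps_tail m = range (\<lambda>g. fps_X ^ m * g)"

definition poly_algs :: "nat \<Rightarrow> 'k::field poly set set" where
  "poly_algs m = {A. is_subalgebra smult A \<and> poly_tail m \<subseteq> A \<and> monom 1 (m - 1) \<notin> A}"

definition fps_algs :: "nat \<Rightarrow> 'k::field fps set set" where
  "fps_algs m = {B. is_subalgebra fps_scale B \<and> fps_tail m \<subseteq> B \<and> fps_X ^ (m - 1) \<notin> B}"

text \<open>An element has the form \<open>x^\<gamma> + (\<Sum>j>\<gamma>. \<lambda>\<^sub>j x^j)\<close> iff its coefficients below
  \<open>\<gamma>\<close> vanish and its coefficient at \<open>\<gamma>\<close> is 1.\<close>

definition poly_orders :: "nat \<Rightarrow> 'k::field poly set \<Rightarrow> nat set" where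
  "poly_orders m A =
     {\<gamma>. 1 \<le> \<gamma> \<and> \<gamma> \<le> m - 1 \<and> (\<exists>p\<in>A. coeff p \<gamma> = 1 \<and> (\<forall>j<\<gamma>. coeff p j = 0))}"

definition fps_orders :: "nat \<Rightarrow> 'k::field fps set \<Rightarrow> nat set" where
  "fps_orders m B =
     {\<gamma>. 1 \<le> \<gamma> \<and> \<gamma> \<le> m - 1 \<and> (\<exists>f\<in>B. fps_nth f \<gamma> = 1 \<and> (\<forall>j<\<gamma>. fps_nth f j = 0))}"

definition poly_algs_of :: "nat \<Rightarrow> nat set \<Rightarrow> 'k::field poly set set" where
  "poly_algs_of m \<Gamma> = {A \<in> poly_algs m. poly_orders m A = \<Gamma>}"

definition fps_algs_of :: "nat \<Rightarrow> nat set \<Rightarrow> 'k::field fps set set" where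
  "fps_algs_of m \<Gamma> = {B \<in> fps_algs m. fps_orders m B = \<Gamma>}"

definition complete_alg :: "nat \<Rightarrow> 'k::field poly set \<Rightarrow> 'k fps set" where
  "complete_alg m A = fps_of_poly ` A + fps_tail m"

definition fps_quot :: "nat \<Rightarrow> 'k::field fps set \<Rightarrow> 'k fps set set" where
  "fps_quot m B = (\<lambda>f. f +o fps_tail m) ` B"

text \<open>The identification of \<open>K[[x]]/x^m K[[x]]\<close> with the span of \<open>1, x, \<dots>, x^(m-1)\<close> sends
  such a polynomial to its coset. A subspace of the quotient is regarded as a subspace of
  that span by taking its preimage; the lemma after the definition shows that this
  identification is bijective.\<close>

definition quot_as_polys :: "nat \<Rightarrow> 'k::field fps set set \<Rightarrow> 'k poly set" where
  "quot_as_polys m Q = {p. (\<forall>i\<ge>m. coeff p i = 0) \<and> fps_of_poly p +o fps_tail m \<in> Q}"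

lemma mem_fps_tail_iff: "f \<in> fps_tail m \<longleftrightarrow> (\<forall>i<m. fps_nth f i = 0)"
proof
  assume "\<forall>i<m. fps_nth f i = 0"
  then have "f = fps_X ^ m * Abs_fps (\<lambda>n. fps_nth f (n + m))"
    by (intro fps_ext) (simp add: fps_X_power_mult_nth)
  then show "f \<in> fps_tail m"
    unfolding fps_tail_def by blast
qed (auto simp: fps_tail_def fps_X_power_mult_nth)

lemma fps_coset_eq_iff:
  "f +o fps_tail m = g +o fps_tail m \<longleftrightarrow> (\<forall>i<m. fps_nth f i = fps_nth g i)"
proof
  assume "f +o fps_tail m = g +o fps_tail m"
  moreover have "f \<in> f +o fps_tail m"
    unfolding elt_set_plus_def by (auto intro!: bexI[of _ 0] simp: mem_fps_tail_iff)
  ultimately obtain h where "h \<in> fps_tail m" "f = g + h"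
    unfolding elt_set_plus_def by blast
  then show "\<forall>i<m. fps_nth f i = fps_nth g i"
    by (simp add: mem_fps_tail_iff)
next
  have mem: "h \<in> u +o fps_tail m \<longleftrightarrow> (\<forall>i<m. fps_nth h i = fps_nth u i)" for h u :: "'a fps"
  proof
    assume "\<forall>i<m. fps_nth h i = fps_nth u i"
    then have "h - u \<in> fps_tail m" "h = u + (h - u)"
      by (simp_all add: mem_fps_tail_iff)
    then show "h \<in> u +o fps_tail m"
      unfolding elt_set_plus_def by blast
  qed (auto simp: elt_set_plus_def mem_fps_tail_iff)
  assume "\<forall>i<m. fps_nth f i = fps_nth g i"
  then show "f +o fps_tail m = g +o fps_tail m"
    by (auto simp: mem)
qed

lemma bij_betw_polys_fps_quot:
  "bij_betw (\<lambda>p. fps_of_poly p +o fps_tail m)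
     {p :: 'k::field poly. \<forall>i\<ge>m. coeff p i = 0} (fps_quot m UNIV)"
  unfolding bij_betw_def
proof
  show "inj_on (\<lambda>p. fps_of_poly p +o fps_tail m) {p :: 'k poly. \<forall>i\<ge>m. coeff p i = 0}"
    by (rule inj_onI) (metis (mono_tags, lifting) fps_coset_eq_iff fps_of_poly_nth
        linorder_not_le mem_Collect_eq poly_eqI)
  have "f +o fps_tail m \<in> (\<lambda>p. fps_of_poly p +o fps_tail m) ` {p. \<forall>i\<ge>m. coeff p i = 0}"
    for f :: "'k fps"
  proof (rule image_eqI)
    let ?p = "\<Sum>i<m. monom (fps_nth f i) i"
    show "?p \<in> {p. \<forall>i\<ge>m. coeff p i = 0}"
      by (simp add: coeff_sum)
    show "f +o fps_tail m = fps_of_poly ?p +o fps_tail m"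
      by (simp add: fps_coset_eq_iff coeff_sum)
  qed
  then show "(\<lambda>p. fps_of_poly p +o fps_tail m) ` {p. \<forall>i\<ge>m. coeff p i = 0}
      = (fps_quot m UNIV :: 'k fps set set)"
    by (auto simp: fps_quot_def)
qed

definition polynomial_alg :: "nat \<Rightarrow> 'k::field fps set \<Rightarrow> 'k poly set" where
  "polynomial_alg m B = quot_as_polys m (fps_quot m B) + poly_tail m"

end

theory Submission
  imports Defs
begin

text \<open>Membership in a subspace containing \<open>x^m K[x]\<close> or \<open>x^m K[[x]]\<close> depends only on the
  coefficients of order below \<open>m\<close>. Hence the completion of \<open>A\<close> consists of the power series that
  agree below order \<open>m\<close> with an element of \<open>A\<close>, and the inverse map is \<open>B \<mapsto> B \<inter> K[x]\<close>.\<close>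

lemma mem_poly_tail_iff: "p \<in> poly_tail m \<longleftrightarrow> (\<forall>i<m. coeff p i = 0)"
  unfolding poly_tail_def using monom_1_dvd_iff'[of m p] by (auto simp: dvd_def)

lemma ex_poly_coeff_eq_fps_nth:
  fixes f :: "'a::comm_ring_1 fps"
  obtains p where "\<forall>i<m. coeff p i = fps_nth f i" "\<forall>i\<ge>m. coeff p i = 0"
proof
  show "\<forall>i<m. coeff (\<Sum>i<m. monom (fps_nth f i) i) i = fps_nth f i"
    "\<forall>i\<ge>m. coeff (\<Sum>i<m. monom (fps_nth f i) i) i = 0"
    by (auto simp: coeff_sum)
qed

text \<open>Interpreting the vector space once makes \<open>subspace\<close> usable as plain closure
  conditions. Membership of 0 is absorbed because 0 is the multiple of 1 by the scalar 0.\<close>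

lemma is_subalgebra_smult_iff:
  "is_subalgebra smult (A :: 'k::field poly set) \<longleftrightarrow>
     1 \<in> A \<and> (\<forall>p\<in>A. \<forall>q\<in>A. p + q \<in> A) \<and> (\<forall>c. \<forall>p\<in>A. smult c p \<in> A) \<and>
     (\<forall>p\<in>A. \<forall>q\<in>A. p * q \<in> A)"
proof -
  interpret vector_space "smult :: 'k \<Rightarrow> 'k poly \<Rightarrow> 'k poly"
    by (rule vector_space_smult)
  have "0 \<in> A" if "1 \<in> A" "\<forall>c. \<forall>p\<in>A. smult c p \<in> A"
    using that(2)[rule_format, OF that(1), of 0] by simp
  then show ?thesis
    unfolding is_subalgebra_def subspace_def by blast
qed

lemma is_subalgebra_fps_scale_iff:
  "is_subalgebra fps_scale (B :: 'k::field fps set) \<longleftrightarrow>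
     1 \<in> B \<and> (\<forall>f\<in>B. \<forall>g\<in>B. f + g \<in> B) \<and> (\<forall>c. \<forall>f\<in>B. fps_const c * f \<in> B) \<and>
     (\<forall>f\<in>B. \<forall>g\<in>B. f * g \<in> B)"
proof -
  interpret vector_space "fps_scale :: 'k \<Rightarrow> 'k fps \<Rightarrow> 'k fps"
    by (rule vector_space_fps_scale)
  have "0 \<in> B" if "1 \<in> B" "\<forall>c. \<forall>f\<in>B. fps_const c * f \<in> B"
    using that(2)[rule_format, OF that(1), of 0] by simp
  then show ?thesis
    unfolding is_subalgebra_def subspace_def by blast
qed

text \<open>The difference \<open>q - p\<close> is a multiple of \<open>x^m\<close>, hence lies in
  \<open>A\<close>.\<close>

lemma poly_algs_coeff_cong:
  assumes "A \<in> poly_algs m" "p \<in> A" "\<forall>i<m. coeff q i = coeff p i"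
  shows "q \<in> A"
proof -
  have "q - p \<in> A"
    using assms mem_poly_tail_iff[of "q - p" m] by (auto simp: poly_algs_def)
  then have "p + (q - p) \<in> A"
    using assms unfolding poly_algs_def is_subalgebra_smult_iff by blast
  then show ?thesis by simp
qed

lemma fps_algs_nth_cong:
  assumes "B \<in> fps_algs m" "f \<in> B" "\<forall>i<m. fps_nth g i = fps_nth f i"
  shows "g \<in> B"
proof -
  have "g - f \<in> B"
    using assms mem_fps_tail_iff[of "g - f" m] by (auto simp: fps_algs_def)
  then have "f + (g - f) \<in> B"
    using assms unfolding fps_algs_def is_subalgebra_fps_scale_iff by blast
  then show ?thesis by simp
qed

text \<open>Adding an element of the tail changes exactly the coefficients from order
  \<open>m\<close> on. This replaces the set sum in every later argument about completions.\<close>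

lemma mem_complete_alg_iff:
  "f \<in> complete_alg m A \<longleftrightarrow> (\<exists>p\<in>A. \<forall>i<m. fps_nth f i = coeff p i)"
proof
  assume "\<exists>p\<in>A. \<forall>i<m. fps_nth f i = coeff p i"
  then obtain p where p: "p \<in> A" "\<forall>i<m. fps_nth f i = coeff p i" by blast
  then have "f - fps_of_poly p \<in> fps_tail m"
    by (simp add: mem_fps_tail_iff)
  with p have "fps_of_poly p + (f - fps_of_poly p) \<in> complete_alg m A"
    unfolding complete_alg_def by (blast intro: set_plus_intro)
  then show "f \<in> complete_alg m A" by simp
qed (fastforce simp: complete_alg_def set_plus_def mem_fps_tail_iff)

text \<open>\<open>B\<close> is a union of cosets of the tail, and every polynomial is its
  truncation below degree \<open>m\<close> plus a multiple of \<open>x^m\<close>.\<close>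

lemma polynomial_alg_eq:
  assumes B: "B \<in> fps_algs m"
  shows "polynomial_alg m B = {p. fps_of_poly p \<in> B}"
proof -
  \<comment> \<open>A coset in the quotient is only known to come from some element of
    \<open>B\<close>; by congruence below order \<open>m\<close> every other representative is in
    \<open>B\<close> too.\<close>
  have quot: "fps_of_poly q +o fps_tail m \<in> fps_quot m B \<longleftrightarrow> fps_of_poly q \<in> B" for q
    using fps_algs_nth_cong[OF B] by (force simp: fps_quot_def fps_coset_eq_iff image_iff)
  show ?thesis
  proof (intro set_eqI iffI)
    fix p
    assume "p \<in> polynomial_alg m B"
    then obtain q t where "fps_of_poly q \<in> B" "t \<in> poly_tail m" "p = q + t"
      unfolding polynomial_alg_def quot_as_polys_def quot by (auto elim: set_plus_elim)
    then show "p \<in> {p. fps_of_poly p \<in> B}"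
      using fps_algs_nth_cong[OF B, of "fps_of_poly q" "fps_of_poly p"]
      by (simp add: mem_poly_tail_iff)
  next
    fix p
    assume p: "p \<in> {p. fps_of_poly p \<in> B}"
    \<comment> \<open>\<open>q\<close> is the truncation of \<open>p\<close>, so that
      \<open>p - q\<close> is the summand from \<open>poly_tail m\<close>.\<close>
    obtain q where q: "\<forall>i<m. coeff q i = coeff p i" "\<forall>i\<ge>m. coeff q i = 0"
      using ex_poly_coeff_eq_fps_nth[of m "fps_of_poly p"] by auto
    then have "q \<in> quot_as_polys m (fps_quot m B)"
      using p fps_algs_nth_cong[OF B, of "fps_of_poly p" "fps_of_poly q"]
      by (simp add: quot_as_polys_def quot)
    moreover have "p - q \<in> poly_tail m"
      using q by (simp add: mem_poly_tail_iff)
    ultimately have "q + (p - q) \<in> polynomial_alg m B"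
      unfolding polynomial_alg_def by (rule set_plus_intro)
    then show "p \<in> polynomial_alg m B" by simp
  qed
qed

lemma complete_alg_in_fps_algs:
  assumes A: "A \<in> poly_algs m" and "m > 0"
  shows "complete_alg m A \<in> fps_algs m"
proof -
  have sub: "1 \<in> A" "\<And>p q. p \<in> A \<Longrightarrow> q \<in> A \<Longrightarrow> p + q \<in> A" "\<And>c p. p \<in> A \<Longrightarrow> smult c p \<in> A"
    "\<And>p q. p \<in> A \<Longrightarrow> q \<in> A \<Longrightarrow> p * q \<in> A"
    and not_in: "monom 1 (m - 1) \<notin> A"
    using A by (auto simp: poly_algs_def is_subalgebra_smult_iff)
  have "is_subalgebra fps_scale (complete_alg m A)"
    unfolding is_subalgebra_fps_scale_iff mem_complete_alg_iff
  proof (intro conjI ballI allI)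
    show "\<exists>p\<in>A. \<forall>i<m. fps_nth 1 i = coeff p i"
      using sub(1) by (auto intro!: bexI[of _ 1])
  next
    fix f g assume "f \<in> complete_alg m A" "g \<in> complete_alg m A"
    then obtain p q where pq: "p \<in> A" "\<forall>i<m. fps_nth f i = coeff p i"
      "q \<in> A" "\<forall>i<m. fps_nth g i = coeff q i"
      unfolding mem_complete_alg_iff by blast
    then show "\<exists>p\<in>A. \<forall>i<m. fps_nth (f + g) i = coeff p i"
      by (intro bexI[of _ "p + q"] sub) auto
    \<comment> \<open>A coefficient of a product at index \<open>i\<close> involves only
      coefficients of the factors at indices up to \<open>i\<close>, so agreement below order
      \<open>m\<close> is multiplicative.\<close>
    show "\<exists>p\<in>A. \<forall>i<m. fps_nth (f * g) i = coeff p i"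
      using pq by (intro bexI[of _ "p * q"] sub)
        (auto simp: fps_mult_nth coeff_mult atLeast0AtMost intro!: sum.cong)
  next
    fix c f assume "f \<in> complete_alg m A"
    then obtain p where "p \<in> A" "\<forall>i<m. fps_nth f i = coeff p i"
      unfolding mem_complete_alg_iff by blast
    then show "\<exists>p\<in>A. \<forall>i<m. fps_nth (fps_const c * f) i = coeff p i"
      by (intro bexI[of _ "smult c p"] sub) auto
  qed
  \<comment> \<open>The witness is the zero polynomial, which is in \<open>A\<close> as 0 times
    1.\<close>
  moreover have "fps_tail m \<subseteq> complete_alg m A"
    using sub(3)[OF sub(1), of 0]
    by (auto simp: mem_complete_alg_iff mem_fps_tail_iff intro!: bexI[of _ 0])
  moreover have "fps_X ^ (m - 1) \<notin> complete_alg m A"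
  proof
    assume "fps_X ^ (m - 1) \<in> complete_alg m A"
    then obtain p where "p \<in> A" "\<forall>i<m. fps_nth (fps_X ^ (m - 1)) i = coeff p i"
      unfolding mem_complete_alg_iff by blast
    moreover from this have "\<forall>i<m. coeff (monom 1 (m - 1)) i = coeff p i"
      by (metis coeff_monom fps_X_power_nth)
    ultimately have "monom 1 (m - 1) \<in> A"
      using poly_algs_coeff_cong[OF A] by blast
    with not_in show False ..
  qed
  ultimately show ?thesis by (simp add: fps_algs_def)
qed

text \<open>By \<open>polynomial_alg_eq\<close> this set is the preimage of \<open>B\<close> under
  the algebra homomorphism \<open>fps_of_poly\<close>, so each condition is pulled back from
  \<open>B\<close>.\<close>

lemma polynomial_alg_in_poly_algs:
  assumes B: "B \<in> fps_algs m"
  shows "polynomial_alg m B \<in> poly_algs m"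
proof -
  have "poly_tail m \<subseteq> {p. fps_of_poly p \<in> B}"
    using B by (auto simp: fps_algs_def mem_fps_tail_iff mem_poly_tail_iff)
  then show ?thesis
    using B unfolding polynomial_alg_eq[OF B] poly_algs_def fps_algs_def
      is_subalgebra_smult_iff is_subalgebra_fps_scale_iff
    by (auto simp: fps_of_poly_add fps_of_poly_mult fps_of_poly_smult fps_of_poly_monom)
qed

text \<open>For an order below \<open>m\<close>, the conditions on an element concern only
  coefficients below \<open>m\<close>, which the completion shares with \<open>A\<close>.\<close>

lemma fps_orders_complete_alg:
  assumes "m > 0"
  shows "fps_orders m (complete_alg m A) = poly_orders m A"
proof -
  have "(\<exists>f\<in>complete_alg m A. fps_nth f \<gamma> = 1 \<and> (\<forall>j<\<gamma>. fps_nth f j = 0)) \<longleftrightarrow>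
      (\<exists>p\<in>A. coeff p \<gamma> = 1 \<and> (\<forall>j<\<gamma>. coeff p j = 0))" if "\<gamma> < m" for \<gamma>
  proof
    assume "\<exists>p\<in>A. coeff p \<gamma> = 1 \<and> (\<forall>j<\<gamma>. coeff p j = 0)"
    then obtain p where "p \<in> A" "coeff p \<gamma> = 1" "\<forall>j<\<gamma>. coeff p j = 0" by blast
    then show "\<exists>f\<in>complete_alg m A. fps_nth f \<gamma> = 1 \<and> (\<forall>j<\<gamma>. fps_nth f j = 0)"
      by (intro bexI[of _ "fps_of_poly p"]) (auto simp: mem_complete_alg_iff)
  next
    assume "\<exists>f\<in>complete_alg m A. fps_nth f \<gamma> = 1 \<and> (\<forall>j<\<gamma>. fps_nth f j = 0)"
    then obtain f p where "fps_nth f \<gamma> = 1" "\<forall>j<\<gamma>. fps_nth f j = 0"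
      "p \<in> A" "\<forall>i<m. fps_nth f i = coeff p i"
      by (metis mem_complete_alg_iff)
    with that show "\<exists>p\<in>A. coeff p \<gamma> = 1 \<and> (\<forall>j<\<gamma>. coeff p j = 0)"
      by (intro bexI[of _ p]) auto
  qed
  \<comment> \<open>Subtraction on naturals is truncated, so the equivalence relies on
    \<open>m > 0\<close>: for \<open>m = 0\<close> it fails at 0.\<close>
  moreover have "\<gamma> \<le> m - 1 \<longleftrightarrow> \<gamma> < m" for \<gamma>
    using assms by linarith
  ultimately show ?thesis by (auto simp: fps_orders_def poly_orders_def)
qed

lemma complete_polynomial_alg:
  assumes B: "B \<in> fps_algs m"
  shows "complete_alg m (polynomial_alg m B) = B"
proof (intro set_eqI iffI)
  fix f assume "f \<in> complete_alg m (polynomial_alg m B)"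
  then obtain p where "fps_of_poly p \<in> B" "\<forall>i<m. fps_nth f i = coeff p i"
    by (auto simp: mem_complete_alg_iff polynomial_alg_eq[OF B])
  then show "f \<in> B"
    using fps_algs_nth_cong[OF B, of "fps_of_poly p" f] by simp
next
  fix f assume f: "f \<in> B"
  \<comment> \<open>The truncation of \<open>f\<close> is a polynomial, and it stays in
    \<open>B\<close> because it agrees with \<open>f\<close> below order \<open>m\<close>.\<close>
  obtain p where p: "\<forall>i<m. coeff p i = fps_nth f i"
    using ex_poly_coeff_eq_fps_nth by metis
  then have "fps_of_poly p \<in> B"
    using f fps_algs_nth_cong[OF B, of f "fps_of_poly p"] by simp
  with p show "f \<in> complete_alg m (polynomial_alg m B)"
    by (auto simp: mem_complete_alg_iff polynomial_alg_eq[OF B])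
qed

text \<open>A polynomial in the completion agrees below order \<open>m\<close> with an element of
  \<open>A\<close>, so it already lies in \<open>A\<close>.\<close>

lemma polynomial_complete_alg:
  assumes A: "A \<in> poly_algs m" and "m > 0"
  shows "polynomial_alg m (complete_alg m A) = A"
  unfolding polynomial_alg_eq[OF complete_alg_in_fps_algs[OF assms]] mem_complete_alg_iff
  using poly_algs_coeff_cong[OF A] by auto

theorem proposition1p1:
  fixes m :: nat and \<Gamma> :: "nat set"
  assumes "m \<ge> 2" and "\<Gamma> \<in> semigroup_parts m"
  shows "bij_betw (complete_alg m) (poly_algs_of m \<Gamma>)
           (fps_algs_of m \<Gamma> :: 'k::alg_closed_field fps set set)
       \<and> (\<forall>B \<in> (fps_algs_of m \<Gamma> :: 'k fps set set).
            polynomial_alg m B \<in> poly_algs_of m \<Gamma> \<and> complete_alg m (polynomial_alg m B) = B)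
       \<and> (\<forall>A \<in> (poly_algs_of m \<Gamma> :: 'k poly set set). polynomial_alg m (complete_alg m A) = A)"
proof -
  have m: "m > 0" using assms(1) by simp
  have in_fps_algs_of: "complete_alg m A \<in> fps_algs_of m \<Gamma>"
    and left_inv: "polynomial_alg m (complete_alg m A) = A"
    if "A \<in> poly_algs_of m \<Gamma>" for A :: "'k poly set"
    using that m
    by (auto simp: poly_algs_of_def fps_algs_of_def complete_alg_in_fps_algs
        fps_orders_complete_alg polynomial_complete_alg)
  \<comment> \<open>The orders of \<open>polynomial_alg m B\<close> are those of its completion,
    which is \<open>B\<close> itself.\<close>
  have in_poly_algs_of: "polynomial_alg m B \<in> poly_algs_of m \<Gamma>"
    and right_inv: "complete_alg m (polynomial_alg m B) = B"
    if "B \<in> fps_algs_of m \<Gamma>" for B :: "'k fps set"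
    using that fps_orders_complete_alg[OF m, of "polynomial_alg m B"]
    by (auto simp: poly_algs_of_def fps_algs_of_def polynomial_alg_in_poly_algs
        complete_polynomial_alg)
  have "bij_betw (complete_alg m) (poly_algs_of m \<Gamma>) (fps_algs_of m \<Gamma> :: 'k fps set set)"
    by (rule bij_betw_byWitness[where f' = "polynomial_alg m"])
      (use in_fps_algs_of left_inv in_poly_algs_of right_inv in blast)+
  with left_inv in_poly_algs_of right_inv show ?thesis by blast
qed

end
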